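(* Let $G$ be an irreducible finite loopless multigraph with vertex set $\{1,\dots,n\}$, $n\ge 2$, and let $\mathbf{P}$ be a commuting reconstructing predistance matrix on $G$. Then there is a regular embedding $f:V(G)\to\mathbb{R}^{\zeta(\mathbf{P})}$ of $G$ with $\|f(i)-f(j)\|^2=\mathbf{P}_{i,j}-2\lambda$ for all $i\neq j$, where $\lambda$ is the smallest eigenvalue of the restriction of $\Lambda(\mathbf{P})$ to the orthogonal complement of the all-ones vector $\mathbf{1}$.
   Context: $\mu(i,j)$ is the number of edges with endpoints $i,j$ (so $\mu(i,i)=0$). Distinct vertices $x,y$ are twins if $\mu(x,v)=\mu(y,v)$ for all $v\neq x,y$; $G$ is irreducible if it has no twins. $\mathrm{Aut}(G)$ is the group of bijections $g$ of $V(G)$ with $\mu(g(x),g(y))=\mu(x,y)$. A predistance matrix is an $n\times n$ real symmetric matrix with zero diagonal; it is commuting if $\mathbf{P}_{g(i),g(j)}=\mathbf{P}_{i,j}$ for all $g\in\mathrm{Aut}(G)$ and all $i,j$, and reconstructing if there is $\Xi:\mathbb{R}\to\mathbb{N}$ with $\mu(i,j)=\Xi(\mathbf{P}_{i,j})$ for all $i,j\in\{1,\dots,n\}$. $\Lambda(\mathbf{P})=-\frac12(\mathbf{I}-\frac1n\mathbf{J})\mathbf{P}(\mathbf{I}-\frac1n\mathbf{J})$ with $\mathbf{J}$ the all-ones matrix; $0$ is an eigenvalue of $\Lambda(\mathbf{P})$. Define $\zeta(\mathbf{P})$: if the smallest eigenvalue of $\Lambda(\mathbf{P})$ is negative with multiplicity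 $m$, $\zeta(\mathbf{P})=n-m-1$; if it is $0$ with multiplicity $m>1$, $\zeta(\mathbf{P})=n-m$; if it is $0$ with multiplicity $1$ and the second smallest eigenvalue has multiplicity $m$, $\zeta(\mathbf{P})=n-m-1$. For $Q\subseteq\mathbb{R}^k$, $\omega(k,Q)$ is the group of isometries of $\mathbb{R}^k$ mapping $Q$ onto itself; $f:V(G)\to\mathbb{R}^k$ is a regular embedding if $\mathrm{Aut}(G)\cong\omega(k,f(V(G)))$. *)

theory Defs
  imports
    "HOL-Algebra.Bij"
    "HOL-Library.Multiset"
    "Jordan_Normal_Form.Spectral_Radius"
begin

(* Vertices are numbered 0, ..., n - 1, in accordance with the matrix indices of
   Jordan_Normal_Form.  A finite loopless multigraph is the multiset of its edges, each
   edge being the two-element set of its endpoints. *)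

type_synonym mgraph = "nat set multiset"

definition loopless_mgraph :: "nat \<Rightarrow> mgraph \<Rightarrow> bool" where
  "loopless_mgraph n G \<longleftrightarrow> (\<forall>e\<in>set_mset G. e \<subseteq> {..<n} \<and> card e = 2)"

definition mu :: "mgraph \<Rightarrow> nat \<Rightarrow> nat \<Rightarrow> nat" where
  "mu G i j = count G {i, j}"

definition twins :: "nat \<Rightarrow> mgraph \<Rightarrow> nat \<Rightarrow> nat \<Rightarrow> bool" where
  "twins n G x y \<longleftrightarrow> x < n \<and> y < n \<and> x \<noteq> y \<and>
     (\<forall>v<n. v \<noteq> x \<and> v \<noteq> y \<longrightarrow> mu G x v = mu G y v)"

definition irreducible_mgraph :: "nat \<Rightarrow> mgraph \<Rightarrow> bool" where
  "irreducible_mgraph n G \<longleftrightarrow> (\<nexists>x y. twins n G x y)"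

(* Elements of BijGroup S are extensional, so they correspond one-to-one to the
   bijections of S. *)

definition Aut :: "nat \<Rightarrow> mgraph \<Rightarrow> (nat \<Rightarrow> nat) monoid" where
  "Aut n G = (BijGroup {..<n})
     \<lparr>carrier := {g \<in> Bij {..<n}. \<forall>x<n. \<forall>y<n. mu G (g x) (g y) = mu G x y}\<rparr>"

definition predistance_matrix :: "nat \<Rightarrow> real mat \<Rightarrow> bool" where
  "predistance_matrix n P \<longleftrightarrow>
     P \<in> carrier_mat n n \<and> transpose_mat P = P \<and> (\<forall>i<n. P $$ (i, i) = 0)"

definition commuting_matrix :: "nat \<Rightarrow> mgraph \<Rightarrow> real mat \<Rightarrow> bool" where
  "commuting_matrix n G P \<longleftrightarrow>
     (\<forall>g\<in>carrier (Aut n G). \<forall>i<n. \<forall>j<n. P $$ (g i, g j) = P $$ (i, j))"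

definition reconstructing_matrix :: "nat \<Rightarrow> mgraph \<Rightarrow> real mat \<Rightarrow> bool" where
  "reconstructing_matrix n G P \<longleftrightarrow>
     (\<exists>\<Xi> :: real \<Rightarrow> nat. \<forall>i<n. \<forall>j<n. mu G i j = \<Xi> (P $$ (i, j)))"

definition ones_mat :: "nat \<Rightarrow> real mat" where
  "ones_mat n = mat n n (\<lambda>_. 1)"

definition ones_vec :: "nat \<Rightarrow> real vec" where
  "ones_vec n = vec n (\<lambda>_. 1)"

definition Lam :: "real mat \<Rightarrow> real mat" where
  "Lam P = (let n = dim_row P; C = 1\<^sub>m n - (1 / real n) \<cdot>\<^sub>m ones_mat n
            in (- 1 / 2) \<cdot>\<^sub>m (C * P * C))"

(* For the symmetric matrices considered here algebraic and geometric multiplicities agree. *)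

definition eig_mult :: "real mat \<Rightarrow> real \<Rightarrow> nat" where
  "eig_mult A a = Polynomial.order a (char_poly A)"

(* 0 is always an eigenvalue of Lam P, so its smallest eigenvalue is never positive. *)

definition zeta :: "real mat \<Rightarrow> nat" where
  "zeta P = (let n = dim_row P; A = Lam P; a = Min (spectrum A) in
     if a < 0 then n - eig_mult A a - 1
     else if eig_mult A 0 > 1 then n - eig_mult A 0
     else n - eig_mult A (Min (spectrum A - {0})) - 1)"

(* Eigenvalues of the restriction of A to the orthogonal complement of the all-ones vector,
   which is invariant under A = Lam P. *)

definition spectrum_perp_ones :: "real mat \<Rightarrow> real set" where
  "spectrum_perp_ones A = {a. \<exists>v. eigenvector A v a \<and> v \<bullet> ones_vec (dim_row A) = 0}"

definition vnorm :: "real vec \<Rightarrow> real" where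
  "vnorm v = sqrt (v \<bullet> v)"

definition isometry_group :: "nat \<Rightarrow> real vec set \<Rightarrow> (real vec \<Rightarrow> real vec) monoid" where
  "isometry_group k Q = (BijGroup (carrier_vec k))
     \<lparr>carrier := {g \<in> Bij (carrier_vec k).
        (\<forall>x\<in>carrier_vec k. \<forall>y\<in>carrier_vec k. vnorm (g x - g y) = vnorm (x - y)) \<and> g ` Q = Q}\<rparr>"

definition regular_embedding :: "nat \<Rightarrow> mgraph \<Rightarrow> nat \<Rightarrow> (nat \<Rightarrow> real vec) \<Rightarrow> bool" where
  "regular_embedding n G k f \<longleftrightarrow>
     f \<in> {..<n} \<rightarrow> carrier_vec k \<and> Aut n G \<cong> isometry_group k (f ` {..<n})"

end

(* The vector 1 lies in the kernel of Lam P, so Lam P has an orthonormal eigenbasis q_0, ..., q_(n-1)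
   with q_0 = 1 / sqrt n.  Let lam be the least eigenvalue d_s with s >= 1.  Then Lam P - lam on the
   complement of 1 is positive semidefinite of rank zeta P, and f maps the vertex i to the vector
   of all sqrt (d_s - lam) * q_s(i) with s >= 1 and d_s > lam.  The image of f is centered and its
   coordinate functions are orthogonal, so an isometry is determined by its values on the image,
   and a Gram-preserving permutation of the image extends to an isometry.  Commutation makes
   automorphisms Gram-preserving; reconstruction makes every isometry of the image an
   automorphism; and points with the same image would be twins. *)

theory Submission
  imports Defs
begin

section \<open>Spectral theorem for real symmetric matrices\<close>

text \<open>Over the complex numbers an eigenvalue \<open>z\<close> exists. Moving the symmetric
  matrix across the product of \<open>conjugate v\<close> and \<open>v\<close> gives
  \<open>z = cnj z\<close>, so \<open>z\<close> is a real root of the characteristic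
  polynomial.\<close>

lemma symmetric_real_mat_eigenvector:
  fixes A :: "real mat"
  assumes A: "A \<in> carrier_mat n n" and sym: "A\<^sup>T = A" and n: "n > 0"
  shows "\<exists>e v. eigenvector A v e"
proof -
  define C where "C = map_mat complex_of_real A"
  have C: "C \<in> carrier_mat n n" using A by (simp add: C_def)
  have CT: "C\<^sup>T = C" unfolding C_def by (subst sym[symmetric], rule eq_matI) (use A in auto)
  obtain z v where ev: "eigenvector C v z"
    using spectrum_non_empty[OF C n] by (auto simp: spectrum_def eigenvalue_def)
  then have v: "v \<in> carrier_vec n" "v \<noteq> 0\<^sub>v n" "C *\<^sub>v v = z \<cdot>\<^sub>v v"
    using C by (auto simp: eigenvector_def)
  have cv: "conjugate v \<in> carrier_vec n" using v by simp
  have "C *\<^sub>v conjugate v = conjugate (C *\<^sub>v v)"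
    by (rule eq_vecI) (use C v(1) in \<open>auto simp: scalar_prod_def C_def\<close>)
  then have Ccv: "C *\<^sub>v conjugate v = cnj z \<cdot>\<^sub>v conjugate v"
    using v by (auto simp: conjugate_smult_vec conjugate_complex_def)
  have "z * (conjugate v \<bullet> v) = conjugate v \<bullet> (C *\<^sub>v v)" using v cv by simp
  also have "\<dots> = (C *\<^sub>v conjugate v) \<bullet> v"
    using transpose_vec_mult_scalar[OF C v(1) cv] CT by simp
  also have "\<dots> = cnj z * (conjugate v \<bullet> v)" using v cv by (simp add: Ccv)
  finally have "z * (conjugate v \<bullet> v) = cnj z * (conjugate v \<bullet> v)" .
  moreover have "conjugate v \<bullet> v \<noteq> 0"
    using conjugate_square_eq_0_vec[OF v(1)] v(2) comm_scalar_prod[OF v(1) cv] by simp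
  ultimately have "z = cnj z" by simp
  then have z: "z = of_real (Re z)" by (metis Reals_cnj_iff of_real_Re)
  have "poly (char_poly C) z = 0"
    using ev eigenvalue_root_char_poly[OF C] by (auto simp: eigenvalue_def)
  then have "poly (map_poly of_real (char_poly A)) (complex_of_real (Re z)) = 0"
    using z of_real_hom.char_poly_hom[OF A, where ?'a = complex] by (simp add: C_def)
  then have "poly (char_poly A) (Re z) = 0" by simp
  then show ?thesis using eigenvalue_root_char_poly[OF A] by (auto simp: eigenvalue_def)
qed

text \<open>\<open>H\<close> is the reflection in the hyperplane orthogonal to \<open>w\<close>, the
  difference of \<open>u\<close> and the first unit vector. It exchanges these two unit
  vectors.\<close>

lemma householder:
  fixes u :: "real vec"
  assumes u: "u \<in> carrier_vec n" and uu: "u \<bullet> u = 1" and n: "0 < n"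
  shows "\<exists>H. H \<in> carrier_mat n n \<and> H\<^sup>T = H \<and> H * H = 1\<^sub>m n \<and> col H 0 = u"
proof -
  define w where "w = (\<lambda>i. u $ i - (if i = 0 then 1 else 0))"
  define s where "s = (\<Sum>k<n. w k * w k)"
  (* If u is already the first unit vector, then s = 0, hence c = 0 and H is the identity. *)
  define c where "c = 2 / s"
  define H where "H = mat n n (\<lambda>(i, j). (if i = j then 1 else 0) - c * w i * w j)"
  have H: "H \<in> carrier_mat n n" by (simp add: H_def)
  have HT: "H\<^sup>T = H" by (rule eq_matI) (auto simp: H_def algebra_simps)
  have cs: "c * c * s = 2 * c" by (simp add: c_def)
  have HH: "H * H = 1\<^sub>m n"
  proof (rule eq_matI)
    fix i j assume ij: "i < dim_row (1\<^sub>m n)" "j < dim_col (1\<^sub>m n)"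
    have "(H * H) $$ (i, j) = (\<Sum>k<n. ((if i = k then 1 else 0) - c * w i * w k) *
        ((if k = j then 1 else 0) - c * w k * w j))"
      using ij by (auto simp: H_def scalar_prod_def atLeast0LessThan intro!: sum.cong)
    also have "\<dots> = (\<Sum>k<n. (if k = i then if k = j then 1 else 0 else 0)
       - (if k = i then c * w i * w j else 0) - (if k = j then c * w i * w j else 0) 
       + c * c * w i * w j * (w k * w k))"
      by (rule sum.cong) (auto simp: algebra_simps)
    also have "\<dots> = (if i = j then 1 else 0) - c * w i * w j - c * w i * w j + c * c * w i * w j * s"
      using ij by (simp add: sum.distrib sum_subtractf s_def sum_distrib_left[symmetric])
    also have "c * c * w i * w j * s = 2 * c * (w i * w j)" using cs by (metis (no_types, opaque_lifting) mult.assoc mult.commute)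
    finally show "(H * H) $$ (i, j) = 1\<^sub>m n $$ (i, j)" using ij by simp
  qed (auto simp: H_def)
  \<comment> \<open>As \<open>u\<close> has norm 1, the squared norm of \<open>w\<close> is
    \<open>2 - 2 * u $ 0\<close>. Hence \<open>c * w 0 = -1\<close> unless \<open>s = 0\<close>, and
    the first column of \<open>H\<close> is the unit vector plus \<open>w\<close>, that is,
    \<open>u\<close>.\<close>
  have "s = (\<Sum>k<n. u $ k * u $ k - (if k = 0 then 2 * u $ 0 - 1 else 0))"
    unfolding s_def w_def by (rule sum.cong) (auto simp: algebra_simps)
  also have "\<dots> = 1 - (2 * u $ 0 - 1)"
    using uu u n by (simp add: sum_subtractf scalar_prod_def atLeast0LessThan)
  finally have s: "s = - 2 * w 0" by (simp add: w_def)
  have "- c * w 0 * w i = w i" if "i < n" for i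
  proof (cases "s = 0")
    case True
    then have "\<forall>k\<in>{..<n}. w k * w k = 0" unfolding s_def by (subst sum_nonneg_eq_0_iff[symmetric]) auto
    then show ?thesis using that by auto
  next
    case False
    then show ?thesis using s by (simp add: c_def)
  qed
  then have "col H 0 = u" using u n
    by (intro eq_vecI) (auto simp: H_def w_def algebra_simps)
  with H HT HH show ?thesis by blast
qed

text \<open>Conjugation by the reflection with first column \<open>u\<close> turns \<open>u\<close>
  into the first unit vector, so the first column of \<open>H * A * H\<close> is \<open>e\<close>
  followed by zeros. By symmetry so is the first row, and a symmetric block of size \<open>m\<close>
  remains.\<close>

lemma symmetric_deflation:
  fixes A :: "real mat"
  assumes A: "A \<in> carrier_mat (Suc m) (Suc m)" and sym: "A\<^sup>T = A"
    and u: "u \<in> carrier_vec (Suc m)" and uu: "u \<bullet> u = 1" and Au: "A *\<^sub>v u = e \<cdot>\<^sub>v u"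
  shows "\<exists>H B. H \<in> carrier_mat (Suc m) (Suc m) \<and> H\<^sup>T * H = 1\<^sub>m (Suc m) \<and> col H 0 = u \<and>
    B \<in> carrier_mat m m \<and> B\<^sup>T = B \<and>
    A * H = H * four_block_mat (mat 1 1 (\<lambda>_. e)) (0\<^sub>m 1 m) (0\<^sub>m m 1) B"
proof -
  obtain H where H: "H \<in> carrier_mat (Suc m) (Suc m)" and HT: "H\<^sup>T = H"
    and HH: "H * H = 1\<^sub>m (Suc m)" and H0: "col H 0 = u"
    using householder[OF u uu] by auto
  define M where "M = H * A * H"
  have M: "M \<in> carrier_mat (Suc m) (Suc m)" using H A by (simp add: M_def)
  have MT: "M\<^sup>T = M"
    unfolding M_def using H A HT sym
    by (subst transpose_mult[of _ "Suc m" "Suc m" _ "Suc m"]; (subst transpose_mult[of _ "Suc m" "Suc m" _ "Suc m"])?; 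
      simp add: assoc_mult_mat[of _ "Suc m" "Suc m" _ "Suc m" _ "Suc m"])
  have "H *\<^sub>v u = col (H * H) 0" using H H0 by (subst col_mult2[OF H H]) auto
  then have Hu: "H *\<^sub>v u = unit_vec (Suc m) 0" by (simp add: HH)
  have "col M 0 = (H * A) *\<^sub>v u" unfolding M_def using H A H0
    by (subst col_mult2[of _ "Suc m" "Suc m" _ "Suc m"]) auto
  also have "\<dots> = H *\<^sub>v (e \<cdot>\<^sub>v u)" using H A u Au by (simp add: assoc_mult_mat_vec[of _ "Suc m" "Suc m" _ "Suc m"])
  also have "\<dots> = e \<cdot>\<^sub>v unit_vec (Suc m) 0" using H u Hu by (simp add: mult_mat_vec[OF H u])
  finally have col: "col M 0 = e \<cdot>\<^sub>v unit_vec (Suc m) 0" .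
  have c0: "M $$ (i, 0) = (if i = 0 then e else 0)" if "i < Suc m" for i
  proof -
    have "M $$ (i, 0) = col M 0 $ i" using M that by simp
    then show ?thesis using that by (simp add: col)
  qed
  have r0: "M $$ (0, i) = (if i = 0 then e else 0)" if "i < Suc m" for i
    using c0[OF that] M that by (metis MT carrier_matD index_transpose_mat(1) zero_less_Suc)
  define B where "B = mat m m (\<lambda>(i, j). M $$ (Suc i, Suc j))"
  have "B\<^sup>T = B"
  proof (rule eq_matI)
    fix i j assume "i < dim_row B" "j < dim_col B"
    then have ij: "i < m" "j < m" by (auto simp: B_def)
    have "M $$ (Suc j, Suc i) = M\<^sup>T $$ (Suc i, Suc j)" using M ij by simp
    then show "B\<^sup>T $$ (i, j) = B $$ (i, j)" using ij by (simp add: B_def MT)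
  qed (auto simp: B_def)
  moreover have "B \<in> carrier_mat m m" by (simp add: B_def)
  moreover have "M = four_block_mat (mat 1 1 (\<lambda>_. e)) (0\<^sub>m 1 m) (0\<^sub>m m 1) B"
  proof (rule eq_matI)
    fix i j assume "i < dim_row (four_block_mat (mat 1 1 (\<lambda>_. e)) (0\<^sub>m 1 m) (0\<^sub>m m 1) B)"
      "j < dim_col (four_block_mat (mat 1 1 (\<lambda>_. e)) (0\<^sub>m 1 m) (0\<^sub>m m 1) B)"
    then have "i < Suc m" "j < Suc m" by (auto simp: B_def)
    then show "M $$ (i, j) = four_block_mat (mat 1 1 (\<lambda>_. e)) (0\<^sub>m 1 m) (0\<^sub>m m 1) B $$ (i, j)"
      using c0[of i] r0[of j] by (cases i; cases j) (auto simp: B_def)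
  qed (use M in \<open>auto simp: B_def\<close>)
  moreover have "H * M = A * H"
  proof -
    have "H * M = (H * H) * (A * H)" unfolding M_def using H A
      by (simp add: assoc_mult_mat[of _ "Suc m" "Suc m" _ "Suc m" _ "Suc m"])
    then show ?thesis using H A HH by simp
  qed
  ultimately show ?thesis using H HT HH H0 by (intro exI[of _ H] exI[of _ B]) simp
qed

text \<open>The inductive step of the spectral theorem, with a prescribed first eigenvector.
  Diagonalizability in dimension \<open>m\<close> is a hypothesis, so that the same lemma serves the
  induction and later places the all-ones direction in column 0.\<close>

lemma spectral_extend:
  fixes A :: "real mat"
  assumes A: "A \<in> carrier_mat (Suc m) (Suc m)" and sym: "A\<^sup>T = A"
    and u: "u \<in> carrier_vec (Suc m)" and uu: "u \<bullet> u = 1" and Au: "A *\<^sub>v u = e \<cdot>\<^sub>v u"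
    and spec: "\<And>B :: real mat. B \<in> carrier_mat m m \<Longrightarrow> B\<^sup>T = B \<Longrightarrow>
      \<exists>Q d. Q \<in> carrier_mat m m \<and> Q\<^sup>T * Q = 1\<^sub>m m \<and> B * Q = Q * mat_diag m d"
  shows "\<exists>Q d. Q \<in> carrier_mat (Suc m) (Suc m) \<and> Q\<^sup>T * Q = 1\<^sub>m (Suc m) \<and>
    A * Q = Q * mat_diag (Suc m) d \<and> col Q 0 = u \<and> d 0 = e"
proof -
  let ?fb = "\<lambda>a. four_block_mat (mat 1 1 (\<lambda>_. a :: real)) (0\<^sub>m 1 m) (0\<^sub>m m 1)"
  obtain H B where H: "H \<in> carrier_mat (Suc m) (Suc m)" "H\<^sup>T * H = 1\<^sub>m (Suc m)" "col H 0 = u"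
    and B: "B \<in> carrier_mat m m" "B\<^sup>T = B" and AH: "A * H = H * ?fb e B"
    using symmetric_deflation[OF A sym u uu Au] by blast
  obtain R d where R: "R \<in> carrier_mat m m" "R\<^sup>T * R = 1\<^sub>m m" "B * R = R * mat_diag m d"
    using spec[OF B] by blast
  have fbc: "?fb a X \<in> carrier_mat (Suc m) (Suc m)" if "X \<in> carrier_mat m m" for a X
    using four_block_carrier_mat[of "mat 1 1 (\<lambda>_. a)" 1 1 X m m] that by simp
  have fbm: "?fb a X * ?fb b Y = ?fb (a * b) (X * Y)"
    if "X \<in> carrier_mat m m" "Y \<in> carrier_mat m m" for a b X Y
  proof -
    have "mat 1 1 (\<lambda>_. a) * mat 1 1 (\<lambda>_. b) = mat 1 1 (\<lambda>_. a * b)"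
      by (rule eq_matI) (auto simp: scalar_prod_def)
    then show ?thesis using that
      by (subst mult_four_block_mat[of _ 1 1 _ m _ m _ _ 1 _ m]) auto
  qed
  have fbd: "?fb a (mat_diag m f) = mat_diag (Suc m) (case_nat a f)" for a f
    by (rule eq_matI) (auto simp: mat_diag_def split: nat.split)
  have fb1: "?fb 1 (1\<^sub>m m) = 1\<^sub>m (Suc m)" by (rule eq_matI) auto
  have "(mat 1 1 (\<lambda>_. 1 :: real))\<^sup>T = mat 1 1 (\<lambda>_. 1)" by (rule eq_matI) auto
  then have fbT: "(?fb 1 R)\<^sup>T = ?fb 1 R\<^sup>T" using R
    by (subst transpose_four_block_mat[of _ 1 1 _ m _ m]) auto
  \<comment> \<open>\<open>X\<close> diagonalizes the deflated matrix and fixes the first unit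
    vector, so the first column of \<open>H * X\<close> is still \<open>u\<close>.\<close>
  define X where "X = ?fb 1 R"
  have X: "X \<in> carrier_mat (Suc m) (Suc m)" unfolding X_def by (rule fbc[OF R(1)])
  have XX: "X\<^sup>T * X = 1\<^sub>m (Suc m)" unfolding X_def fbT using R fbm[of "R\<^sup>T" R 1 1] fb1 by simp
  have Xc: "col X 0 = unit_vec (Suc m) 0" using R(1) by (intro eq_vecI) (auto simp: X_def)
  define D where "D = mat_diag (Suc m) (case_nat e d)"
  have D: "D \<in> carrier_mat (Suc m) (Suc m)" by (simp add: D_def)
  have XD: "?fb e B * X = X * D"
    unfolding X_def D_def fbd[symmetric] fbm[OF B(1) R(1)] fbm[OF R(1) mat_diag_dim] R(3) by simp
  note assoc = assoc_mult_mat[of _ "Suc m" "Suc m" _ "Suc m" _ "Suc m"]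
  have Bc: "?fb e B \<in> carrier_mat (Suc m) (Suc m)" by (rule fbc[OF B(1)])
  define Q where "Q = H * X"
  have Q: "Q \<in> carrier_mat (Suc m) (Suc m)" using H X by (simp add: Q_def)
  have "Q\<^sup>T * Q = X\<^sup>T * (H\<^sup>T * H) * X" unfolding Q_def using H(1) X
    by (subst transpose_mult[OF H(1) X]) (simp add: assoc)
  then have QQ: "Q\<^sup>T * Q = 1\<^sub>m (Suc m)" unfolding H(2) using X XX by simp
  have "A * Q = (A * H) * X" using A H X by (simp add: Q_def assoc)
  then have "A * Q = H * (?fb e B * X)" using AH H X Bc by (simp add: assoc)
  then have "A * Q = Q * D" using XD H X D by (simp add: Q_def assoc)
  moreover have "col Q 0 = H *\<^sub>v col X 0" unfolding Q_def by (rule col_mult2[OF H(1) X]) simp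
  then have "col Q 0 = u"
    using H col_mult2[OF H(1) one_carrier_mat[of "Suc m"], of 0] by (simp add: Xc)
  ultimately show ?thesis using Q QQ unfolding D_def by (intro exI[of _ Q] exI[of _ "case_nat e d"]) simp
qed

text \<open>Induction on the dimension: any eigenvector, scaled to norm 1, can be split off.\<close>

lemma symmetric_diagonalization:
  fixes A :: "real mat"
  assumes "A \<in> carrier_mat n n" and "A\<^sup>T = A"
  shows "\<exists>Q d. Q \<in> carrier_mat n n \<and> Q\<^sup>T * Q = 1\<^sub>m n \<and> A * Q = Q * mat_diag n d"
  using assms
proof (induction n arbitrary: A)
  case 0
  then show ?case
    by (intro exI[of _ "1\<^sub>m 0"] exI[of _ "\<lambda>_. 0"] conjI eq_matI)
      (auto simp: mat_diag_def)
next
  case (Suc m)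
  obtain e v where ev: "eigenvector A v e"
    using symmetric_real_mat_eigenvector[OF Suc.prems] by auto
  then have v: "v \<in> carrier_vec (Suc m)" "v \<noteq> 0\<^sub>v (Suc m)" "A *\<^sub>v v = e \<cdot>\<^sub>v v"
    using Suc.prems by (auto simp: eigenvector_def)
  define u where "u = (1 / sqrt (v \<bullet> v)) \<cdot>\<^sub>v v"
  have "v \<bullet> v > 0" using conjugate_square_greater_0_vec[OF v(1)] v(2)
    by (simp add: conjugate_real_def vec_eq_iff conjugate_vec_def)
  then have "u \<bullet> u = 1" using v(1) by (simp add: u_def field_simps)
  moreover have "A *\<^sub>v u = e \<cdot>\<^sub>v u"
    using v Suc.prems by (simp add: u_def mult_mat_vec[OF Suc.prems(1)] smult_smult_assoc mult.commute)
  moreover have "u \<in> carrier_vec (Suc m)" using v by (simp add: u_def)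
  ultimately show ?case using spectral_extend[OF Suc.prems] Suc.IH by blast
qed

section \<open>Multiplicities and spectrum read off a diagonalization\<close>

text \<open>Reduces the algebraic multiplicity in \<open>eig_mult\<close> to counting diagonal
  entries, since a characteristic polynomial that splits has this form.\<close>

lemma order_prod_linear:
  "Polynomial.order a (\<Prod>x\<leftarrow>map d [0..<n]. [:- x, 1:]) = card {s\<in>{..<n}. d s = (a :: 'a :: field)}"
proof (induction n)
  case 0
  then show ?case by (simp add: order_1_eq_0)
next
  case (Suc n)
  let ?p = "\<lambda>n. \<Prod>x\<leftarrow>map d [0..<n]. [:- x, 1 :: 'a:]"
  have nz: "?p k \<noteq> 0" for k by (auto simp: prod_list_zero_iff)
  have "?p (Suc n) = ?p n * [:- d n, 1:]" by simp
  then have "Polynomial.order a (?p (Suc n)) = Polynomial.order a (?p n) + Polynomial.order a [:- d n, 1:]"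
    using nz[of "Suc n"] by (metis order_mult)
  also have "Polynomial.order a [:- d n, 1:] = (if d n = a then 1 else 0)"
    using order_power_n_n[of a 1] by (auto intro!: order_0I)
  also have "Polynomial.order a (?p n) + (if d n = a then 1 else 0) = card {s\<in>{..<Suc n}. d s = a}"
  proof (cases "d n = a")
    case True
    then have "{s\<in>{..<Suc n}. d s = a} = insert n {s\<in>{..<n}. d s = a}" by auto
    then show ?thesis using Suc True by simp
  next
    case False
    then have "{s\<in>{..<Suc n}. d s = a} = {s\<in>{..<n}. d s = a}" by (auto simp: less_Suc_eq)
    then show ?thesis using Suc False by simp
  qed
  finally show ?case .
qed

text \<open>The columns of \<open>Q\<close> form an orthonormal eigenbasis of \<open>A\<close>;
  column \<open>s\<close> belongs to the eigenvalue \<open>d s\<close>.\<close>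

locale orthogonal_diagonalization =
  fixes n :: nat and A Q :: "real mat" and d :: "nat \<Rightarrow> real"
  assumes A [simp]: "A \<in> carrier_mat n n" and Q [simp]: "Q \<in> carrier_mat n n"
    and QTQ: "Q\<^sup>T * Q = 1\<^sub>m n" and AQ: "A * Q = Q * mat_diag n d"
begin

lemma QQT: "Q * Q\<^sup>T = 1\<^sub>m n"
  using mat_mult_left_right_inverse[OF _ Q QTQ] by simp

lemma A_eq: "A = Q * mat_diag n d * Q\<^sup>T"
proof -
  have "Q * mat_diag n d * Q\<^sup>T = A * (Q * Q\<^sup>T)"
    unfolding AQ[symmetric] by (rule assoc_mult_mat[of _ n n _ n _ n]) auto
  then show ?thesis by (simp add: QQT right_mult_one_mat[OF A])
qed

lemma dims [simp]: "dim_row Q = n" "dim_col Q = n" "dim_row A = n" "dim_col A = n"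
  using A Q by (blast dest: carrier_matD)+

lemma A_entry:
  assumes "i < n" "j < n"
  shows "A $$ (i, j) = (\<Sum>s<n. d s * Q $$ (i, s) * Q $$ (j, s))"
  using assms by (subst A_eq, subst mat_diag_mult_right[OF Q])
    (auto simp: scalar_prod_def atLeast0LessThan mult_ac intro!: sum.cong)

lemma Q_rows:
  assumes "i < n" "j < n"
  shows "(\<Sum>s<n. Q $$ (i, s) * Q $$ (j, s)) = (if i = j then 1 else 0)"
proof -
  have "(Q * Q\<^sup>T) $$ (i, j) = (\<Sum>s<n. Q $$ (i, s) * Q $$ (j, s))"
    using assms by (auto simp: scalar_prod_def atLeast0LessThan)
  then show ?thesis using assms by (simp add: QQT)
qed

lemma Q_cols:
  assumes "s < n" "t < n"
  shows "(\<Sum>i<n. Q $$ (i, s) * Q $$ (i, t)) = (if s = t then 1 else 0)"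
proof -
  have "(Q\<^sup>T * Q) $$ (s, t) = (\<Sum>i<n. Q $$ (i, s) * Q $$ (i, t))"
    using assms by (auto simp: scalar_prod_def atLeast0LessThan)
  then show ?thesis using assms by (simp add: QTQ)
qed

lemma char_poly_A: "char_poly A = (\<Prod>x\<leftarrow>map d [0..<n]. [:- x, 1:])"
proof -
  have "similar_mat A (mat_diag n d)"
    by (rule similar_matI[of _ _ Q "Q\<^sup>T" n]) (auto simp: QTQ QQT A_eq[symmetric])
  then have "char_poly A = char_poly (mat_diag n d)" by (rule char_poly_similar)
  also have "\<dots> = (\<Prod>x\<leftarrow>diag_mat (mat_diag n d). [:- x, 1:])"
    by (rule char_poly_upper_triangular[of _ n]) (auto simp: mat_diag_def)
  also have "diag_mat (mat_diag n d) = map d [0..<n]" by (auto simp: diag_mat_def mat_diag_def)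
  finally show ?thesis .
qed

lemma eig_mult_A: "eig_mult A a = card {s\<in>{..<n}. d s = a}"
  unfolding eig_mult_def char_poly_A by (rule order_prod_linear)

lemma spectrum_A: "spectrum A = d ` {..<n}"
  unfolding spectrum_root_char_poly[OF A] char_poly_A
  by (auto simp: poly_prod_list prod_list_zero_iff image_iff) 

lemma eigenvector_col:
  assumes "s < n"
  shows "eigenvector A (col Q s) (d s)"
proof -
  have "A *\<^sub>v col Q s = col (A * Q) s" using assms by (simp add: col_mult2[OF A Q])
  also have "\<dots> = d s \<cdot>\<^sub>v col Q s" unfolding AQ mat_diag_mult_right[OF Q]
    using assms by (intro eq_vecI) auto
  moreover have "col Q s \<noteq> 0\<^sub>v n"
  proof
    assume "col Q s = 0\<^sub>v n"
    then have "Q $$ (i, s) = 0" if "i < n" for i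
      using that assms by (metis dims(1,2) index_col index_zero_vec(1))
    then show False using Q_cols[OF assms assms] by simp
  qed
  ultimately show ?thesis by (simp add: eigenvector_def carrier_vecI)
qed

end

section \<open>The complement of the all-ones vector and the dimension \<open>zeta\<close>\<close>

text \<open>Column 0 is the normalized all-ones vector, so the columns \<open>1..<n\<close> are an
  eigenbasis of its orthogonal complement. With \<open>n \<ge> 2\<close> that complement is nonzero
  and has a least eigenvalue.\<close>

locale centered_diagonalization = orthogonal_diagonalization +
  assumes n2: "n \<ge> 2" and d0: "d 0 = 0" and col0: "\<And>i. i < n \<Longrightarrow> Q $$ (i, 0) = 1 / sqrt n"
begin

lemma Q_centered:
  assumes "s \<in> {1..<n}"
  shows "(\<Sum>i<n. Q $$ (i, s)) = 0"
proof -
  have "(\<Sum>i<n. Q $$ (i, s)) / sqrt n = (\<Sum>i<n. Q $$ (i, 0) * Q $$ (i, s))"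
    by (simp add: sum_divide_distrib col0)
  also have "\<dots> = 0" using assms n2 Q_cols[of 0 s] by auto
  finally show ?thesis using n2 by simp
qed

text \<open>Let \<open>w\<close> be the coordinates of an eigenvector \<open>v\<close> in the basis
  of columns. Orthogonality to the all-ones vector means \<open>w $ 0 = 0\<close>, so some
  \<open>w $ s\<close> with \<open>s \<ge> 1\<close> is nonzero, and comparing coordinate
  \<open>s\<close> identifies the eigenvalue as \<open>d s\<close>.\<close>

lemma spectrum_perp_ones_A: "spectrum_perp_ones A = d ` {1..<n}"
proof (intro equalityI subsetI)
  fix a assume "a \<in> spectrum_perp_ones A"
  then obtain v where v: "v \<in> carrier_vec n" "v \<noteq> 0\<^sub>v n" "A *\<^sub>v v = a \<cdot>\<^sub>v v"
    and perp: "v \<bullet> ones_vec n = 0"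
    by (auto simp: spectrum_perp_ones_def eigenvector_def)
  define w where "w = Q\<^sup>T *\<^sub>v v"
  have w: "w \<in> carrier_vec n" using v by (simp add: w_def mult_mat_vec_carrier[of _ n n])
  have vw: "v = Q *\<^sub>v w"
    unfolding w_def using v assoc_mult_mat_vec[of Q n n "Q\<^sup>T" n v] by (simp add: QQT)
  have "w \<noteq> 0\<^sub>v n"
  proof
    assume "w = 0\<^sub>v n"
    then have "v = 0\<^sub>v n" by (subst vw) (intro eq_vecI, auto)
    then show False using v by simp
  qed
  then obtain s where s: "s < n" "w $ s \<noteq> 0" using w by (metis carrier_vecD eq_vecI index_zero_vec)
  have "w $ 0 = (\<Sum>i<n. Q $$ (i, 0) * v $ i)"
    using v n2 by (simp add: w_def scalar_prod_def atLeast0LessThan)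
  also have "\<dots> = (v \<bullet> ones_vec n) / sqrt n"
    using v by (simp add: scalar_prod_def atLeast0LessThan ones_vec_def col0 sum_divide_distrib)
  finally have "s \<noteq> 0" using s perp by (intro notI) simp
  \<comment> \<open>The eigenvector equation is carried into the coordinates \<open>w\<close>, where
    \<open>A\<close> acts as the diagonal matrix.\<close>
  have "mat_diag n d *\<^sub>v w = Q\<^sup>T *\<^sub>v (Q *\<^sub>v (mat_diag n d *\<^sub>v w))"
    using assoc_mult_mat_vec[of "Q\<^sup>T" n n Q n "mat_diag n d *\<^sub>v w"] w
    by (simp add: QTQ mult_mat_vec_carrier[of _ n n])
  also have "Q *\<^sub>v (mat_diag n d *\<^sub>v w) = A *\<^sub>v v"
    using assoc_mult_mat_vec[of Q n n "mat_diag n d" n w] assoc_mult_mat_vec[of A n n Q n w] w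
    by (simp add: vw AQ)
  also have "Q\<^sup>T *\<^sub>v \<dots> = a \<cdot>\<^sub>v w" using v by (simp add: w_def mult_mat_vec[of _ n n])
  finally have "(mat_diag n d *\<^sub>v w) $ s = a * w $ s" using w s by simp
  moreover have "(mat_diag n d *\<^sub>v w) $ s = (\<Sum>t<n. (if s = t then d t else 0) * w $ t)"
    using s w by (simp add: mat_diag_def scalar_prod_def atLeast0LessThan)
  then have "(mat_diag n d *\<^sub>v w) $ s = (\<Sum>t<n. (if s = t then d t * w $ t else 0))"
    by (simp add: if_distrib[of "\<lambda>x. x * _"] cong: if_cong)
  then have "(mat_diag n d *\<^sub>v w) $ s = d s * w $ s" using s by simp
  ultimately have "a = d s" using s by simp
  then show "a \<in> d ` {1..<n}" using s \<open>s \<noteq> 0\<close> by auto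
next
  fix a assume "a \<in> d ` {1..<n}"
  then obtain s where s: "s \<in> {1..<n}" "a = d s" by auto
  then have "col Q s \<bullet> ones_vec n = 0"
    using Q_centered[OF s(1)] by (simp add: scalar_prod_def ones_vec_def atLeast0LessThan)
  then show "a \<in> spectrum_perp_ones A"
    using eigenvector_col[of s] s by (auto simp: spectrum_perp_ones_def)
qed

definition "lam = Min (d ` {1..<n})"

lemma lam_le: "s \<in> {1..<n} \<Longrightarrow> lam \<le> d s"
  by (simp add: lam_def)

lemma lam_in: "lam \<in> d ` {1..<n}"
  unfolding lam_def by (rule Min_in) (use n2 in auto)

text \<open>The three cases of \<open>zeta\<close> are the three signs of \<open>lam\<close>, and
  each subtracts the multiplicity of \<open>lam\<close> on the complement from \<open>n - 1\<close>.
  For \<open>lam = 0\<close> the all-ones vector adds one to the multiplicity of 0, which replaces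
  the extra \<open>- 1\<close>. For \<open>lam > 0\<close> the eigenvalue 0 is simple and
  \<open>lam\<close> is the second smallest.\<close>

lemma zeta_A:
  assumes P: "A = Lam P" "dim_row P = n"
  shows "zeta P = card {s\<in>{1..<n}. d s \<noteq> lam}"
proof -
  have split: "{..<n} = insert 0 {1..<n}" using n2 by auto
  have "Min (insert (d 0) (d ` {1..<n})) = min (d 0) lam"
    unfolding lam_def by (rule Min_insert) (use n2 in auto)
  \<comment> \<open>The whole spectrum consists of the spectrum on the complement and the eigenvalue
    0 of column 0.\<close>
  then have m: "Min (d ` {..<n}) = min 0 lam" unfolding split by (simp add: d0)
  have "{1..<n} = {s\<in>{1..<n}. d s \<noteq> lam} \<union> {s\<in>{1..<n}. d s = lam}" by auto
  then have "card {1..<n} = card {s\<in>{1..<n}. d s \<noteq> lam} + card {s\<in>{1..<n}. d s = lam}"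
    by (metis (no_types, lifting) card_Un_disjoint disjoint_iff finite_Un finite_atLeastLessThan mem_Collect_eq)
  then have c: "card {s\<in>{1..<n}. d s \<noteq> lam} = n - 1 - card {s\<in>{1..<n}. d s = lam}" by simp
  have perp: "eig_mult A a = (if a = 0 then 1 else 0) + card {s\<in>{1..<n}. d s = a}" for a
  proof -
    have "{s\<in>{..<n}. d s = a} = (if a = 0 then {0} else {}) \<union> {s\<in>{1..<n}. d s = a}"
      unfolding split by (auto simp: d0)
    then show ?thesis unfolding eig_mult_A by (simp add: card_insert_if)
  qed
  have z: "zeta P = (if min 0 lam < 0 then n - eig_mult A (min 0 lam) - 1
     else if eig_mult A 0 > 1 then n - eig_mult A 0
     else n - eig_mult A (Min (d ` {..<n} - {0})) - 1)"
    unfolding zeta_def Let_def P(2) P(1)[symmetric] spectrum_A m ..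
  consider "lam < 0" | "lam = 0" | "lam > 0" by linarith
  then show ?thesis
  proof cases
    case 1
    then show ?thesis unfolding z c by (simp add: perp)
  next
    case 2
    then have "{s\<in>{1..<n}. d s = 0} \<noteq> {}" using lam_in by auto
    then have "card {s\<in>{1..<n}. d s = 0} > 0" by (simp add: card_gt_0_iff)
    with 2 show ?thesis unfolding z c perp by simp
  next
    case 3
    then have ne: "d s \<noteq> 0" if "s \<in> {1..<n}" for s using lam_le[OF that] by simp
    then have "{s\<in>{1..<n}. d s = 0} = {}" by auto
    then have e0: "eig_mult A 0 = 1" using perp[of 0] by (simp only: card.empty if_True refl add_0_right)
    have "d ` {..<n} - {0} = d ` {1..<n}" unfolding split using ne d0 by auto
    then have "Min (d ` {..<n} - {0}) = lam" by (simp add: lam_def)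
    moreover have "eig_mult A lam = card {s\<in>{1..<n}. d s = lam}" using 3 perp[of lam] by simp
    ultimately show ?thesis unfolding z c using 3 e0 by simp
  qed
qed

end

section \<open>Isometries of a centered configuration with orthogonal axes\<close>

lemma sq_dist_vec:
  fixes x y :: "real vec"
  assumes "x \<in> carrier_vec k" "y \<in> carrier_vec k"
  shows "(x - y) \<bullet> (x - y) = x \<bullet> x + y \<bullet> y - 2 * (x \<bullet> y)"
  using assms comm_scalar_prod[of y k x]
  by (simp add: scalar_prod_minus_distrib[of _ k] minus_scalar_prod_distrib[of _ k])

lemma vnorm_eq_iff: "vnorm x = vnorm y \<longleftrightarrow> x \<bullet> x = y \<bullet> y"
  by (simp add: vnorm_def)

lemma self_scalar_prod_zero:
  fixes x :: "real vec"
  assumes "x \<in> carrier_vec k" "x \<bullet> x = 0" "a < k"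
  shows "x $ a = 0"
proof -
  have "\<forall>b\<in>{0..<k}. x $ b * x $ b = 0"
    using assms by (subst sum_nonneg_eq_0_iff[symmetric]) (auto simp: scalar_prod_def)
  then show ?thesis using assms by simp
qed

text \<open>If the points are the rows of a matrix \<open>F\<close>, then \<open>axes\<close> and
  \<open>c0\<close> say that the transpose of \<open>F\<close> times \<open>F\<close> is an
  invertible diagonal matrix. Thus the points span the space, with explicit inversion formulas, and
  their centroid is the origin.\<close>

locale centered_frame =
  fixes n k :: nat and c :: "nat \<Rightarrow> real" and f :: "nat \<Rightarrow> real vec"
  assumes f [simp]: "i < n \<Longrightarrow> f i \<in> carrier_vec k"
    and inj: "inj_on f {..<n}"
    and n0: "n > 0"
    and centered: "a < k \<Longrightarrow> (\<Sum>i<n. f i $ a) = 0"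
    and axes: "a < k \<Longrightarrow> b < k \<Longrightarrow> (\<Sum>i<n. f i $ a * f i $ b) = (if a = b then c a else 0)"
    and c0: "a < k \<Longrightarrow> c a \<noteq> 0"
begin

lemma f_dim [simp]: "i < n \<Longrightarrow> dim_vec (f i) = k"
  by (rule carrier_vecD[OF f])

text \<open>Summing the equations for the squared distances over all points removes the linear
  terms, because the centroid is 0; so \<open>x\<close> and \<open>y\<close> have equal norms. Then
  they have equal inner products with all points, and these determine the coordinates. No linearity
  of any map is involved.\<close>

lemma eq_if_equidistant:
  assumes x: "x \<in> carrier_vec k" and y: "y \<in> carrier_vec k"
    and dist: "\<And>i. i < n \<Longrightarrow> vnorm (x - f i) = vnorm (y - f i)"
  shows "x = y"
proof -
  have eq: "x \<bullet> x - 2 * (x \<bullet> f i) = y \<bullet> y - 2 * (y \<bullet> f i)" if "i < n" for i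
    using dist[OF that] sq_dist_vec[OF x f[OF that]] sq_dist_vec[OF y f[OF that]]
    by (simp add: vnorm_eq_iff)
  have avg: "(\<Sum>i<n. z \<bullet> f i) = 0" if "z \<in> carrier_vec k" for z
  proof -
    have "(\<Sum>i<n. z \<bullet> f i) = (\<Sum>i<n. \<Sum>a<k. z $ a * f i $ a)"
      by (simp add: scalar_prod_def atLeast0LessThan)
    also have "\<dots> = (\<Sum>a<k. z $ a * (\<Sum>i<n. f i $ a))"
      by (subst sum.swap) (simp add: sum_distrib_left)
    finally show ?thesis by (simp add: centered)
  qed
  have "(\<Sum>i<n. x \<bullet> x - 2 * (x \<bullet> f i)) = (\<Sum>i<n. y \<bullet> y - 2 * (y \<bullet> f i))"
    using eq by (intro sum.cong) auto
  then have "real n * (x \<bullet> x) = real n * (y \<bullet> y)"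
    using avg[OF x] avg[OF y] by (simp add: sum_subtractf sum_distrib_left[symmetric])
  then have xy: "x \<bullet> f i = y \<bullet> f i" if "i < n" for i using n0 eq[OF that] by simp
  \<comment> \<open>Orthogonality of the axes recovers each coordinate of \<open>z\<close> from its
    inner products with the points.\<close>
  have coord: "(\<Sum>i<n. (z \<bullet> f i) * f i $ a) = c a * z $ a" if "z \<in> carrier_vec k" "a < k" for z a
  proof -
    have "(\<Sum>i<n. (z \<bullet> f i) * f i $ a) = (\<Sum>i<n. \<Sum>b<k. z $ b * (f i $ b * f i $ a))"
      using that(1) by (simp add: scalar_prod_def atLeast0LessThan sum_distrib_left sum_distrib_right mult_ac)
    also have "\<dots> = (\<Sum>b<k. z $ b * (\<Sum>i<n. f i $ b * f i $ a))"
      by (subst sum.swap) (simp add: sum_distrib_left)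
    also have "\<dots> = (\<Sum>b<k. if b = a then c a * z $ a else 0)"
      using that by (intro sum.cong) (auto simp: axes)
    finally show ?thesis using that by simp
  qed
  show "x = y"
  proof (rule eq_vecI)
    fix a assume "a < dim_vec y"
    then have a: "a < k" using y by simp
    have "c a * x $ a = c a * y $ a"
      unfolding coord[OF x a, symmetric] coord[OF y a, symmetric] by (simp add: xy)
    then show "x $ a = y $ a" using c0[OF a] by simp
  qed (use x y in simp)
qed

text \<open>The parameter \<open>s\<close> allows the same weights to be used for the original
  points (\<open>id\<close>) and for the rearranged ones.\<close>

definition comb :: "(nat \<Rightarrow> nat) \<Rightarrow> (nat \<Rightarrow> real) \<Rightarrow> real vec" where
  "comb s w = vec k (\<lambda>a. \<Sum>i<n. w i * f (s i) $ a)"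

lemma comb_carrier [simp]: "comb s w \<in> carrier_vec k"
  by (simp add: comb_def)

text \<open>The squared norm is a quadratic form in the weights whose coefficients are the Gram
  matrix, which \<open>s\<close> preserves.\<close>

lemma comb_norm:
  assumes s: "\<And>i. i < n \<Longrightarrow> s i < n"
    and gram: "\<And>i j. i < n \<Longrightarrow> j < n \<Longrightarrow> f (s i) \<bullet> f (s j) = f i \<bullet> f j"
  shows "comb s w \<bullet> comb s w = comb id w \<bullet> comb id w"
proof -
  have expand: "comb t w \<bullet> comb t w = (\<Sum>i<n. \<Sum>j<n. w i * w j * (f (t i) \<bullet> f (t j)))"
    if t: "\<And>i. i < n \<Longrightarrow> t i < n" for t
  proof -
    have "comb t w \<bullet> comb t w = (\<Sum>a<k. \<Sum>i<n. \<Sum>j<n. (w i * f (t i) $ a) * (w j * f (t j) $ a))"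
      by (simp add: comb_def scalar_prod_def atLeast0LessThan sum_product)
    also have "\<dots> = (\<Sum>i<n. \<Sum>j<n. \<Sum>a<k. (w i * f (t i) $ a) * (w j * f (t j) $ a))"
      by (subst sum.swap, rule sum.cong[OF refl], rule sum.swap)
    finally show ?thesis using t
      by (simp add: scalar_prod_def atLeast0LessThan sum_distrib_left mult_ac)
  qed
  show ?thesis using s gram by (simp add: expand)
qed

lemma comb_diff: "comb s v - comb s w = comb s (\<lambda>i. v i - w i)"
  by (rule eq_vecI) (auto simp: comb_def sum_subtractf left_diff_distrib)

text \<open>The dual frame coefficients. The points sum to 0 and so are linearly dependent; this is
  one choice of weights representing \<open>x\<close>, and it is linear in \<open>x\<close>.\<close>

definition coeff :: "real vec \<Rightarrow> nat \<Rightarrow> real" where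
  "coeff x i = (\<Sum>b<k. f i $ b * x $ b / c b)"

lemma coeff_diff:
  assumes "x \<in> carrier_vec k" "y \<in> carrier_vec k"
  shows "coeff (x - y) i = coeff x i - coeff y i"
  using assms
  by (simp add: coeff_def sum_subtractf[symmetric] right_diff_distrib diff_divide_distrib)

lemma comb_coeff:
  assumes x: "x \<in> carrier_vec k"
  shows "comb id (coeff x) = x"
proof (rule eq_vecI)
  fix a assume "a < dim_vec x"
  then have a: "a < k" using x by simp
  have "comb id (coeff x) $ a = (\<Sum>i<n. \<Sum>b<k. (f i $ b * f i $ a) * (x $ b / c b))"
    using a by (simp add: comb_def coeff_def sum_distrib_left sum_distrib_right mult_ac)
  also have "\<dots> = (\<Sum>b<k. (\<Sum>i<n. f i $ b * f i $ a) * (x $ b / c b))"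
    by (subst sum.swap) (simp only: sum_distrib_right)
  also have "\<dots> = (\<Sum>b<k. if b = a then x $ a else 0)"
    using a c0 by (intro sum.cong) (auto simp: axes)
  finally show "comb id (coeff x) $ a = x $ a" using a by simp
qed (use x in \<open>simp add: comb_def\<close>)

lemma comb_delta: "j < n \<Longrightarrow> s j < n \<Longrightarrow> comb s (\<lambda>i. if i = j then 1 else 0) = f (s j)"
  by (rule eq_vecI) (auto simp: comb_def if_distrib[of "\<lambda>x. x * _"] cong: if_cong)

(* U is the linear map that replaces each f i by f (s i) in the expansion x = comb id (coeff x);
   it preserves norms because both sides have the same Gram matrix. *)
lemma isometry_extension_exists:
  assumes s: "\<And>i. i < n \<Longrightarrow> s i < n"
    and gram: "\<And>i j. i < n \<Longrightarrow> j < n \<Longrightarrow> f (s i) \<bullet> f (s j) = f i \<bullet> f j"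
  shows "\<exists>U. (\<forall>x\<in>carrier_vec k. U x \<in> carrier_vec k) \<and>
    (\<forall>x\<in>carrier_vec k. \<forall>y\<in>carrier_vec k. vnorm (U x - U y) = vnorm (x - y)) \<and>
    (\<forall>i<n. U (f i) = f (s i))"
proof (intro exI[of _ "\<lambda>x. comb s (coeff x)"] conjI ballI allI impI)
  fix x y :: "real vec" assume xy: "x \<in> carrier_vec k" "y \<in> carrier_vec k"
  have "comb s (coeff x) - comb s (coeff y) = comb s (coeff (x - y))"
    unfolding comb_diff coeff_diff[OF xy] ..
  moreover have "comb id (coeff (x - y)) = x - y" using xy by (intro comb_coeff) simp
  ultimately show "vnorm (comb s (coeff x) - comb s (coeff y)) = vnorm (x - y)"
    unfolding vnorm_eq_iff using comb_norm[OF s gram] by simp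
next
  fix j assume j: "j < n"
  \<comment> \<open>\<open>?w\<close> is the difference of two families of weights that both
    represent \<open>f j\<close>. It therefore combines the original points to 0, and by equality of
    norms it combines the rearranged points to 0 as well.\<close>
  let ?w = "\<lambda>i. coeff (f j) i - (if i = j then 1 else 0)"
  have eq: "comb s (coeff (f j)) - f (s j) = comb s ?w"
    unfolding comb_delta[of j s, OF j s[OF j], symmetric] by (rule comb_diff)
  have "comb id ?w = comb id (coeff (f j)) - comb id (\<lambda>i. if i = j then 1 else 0)"
    by (rule comb_diff[symmetric])
  also have "\<dots> = f j - f j" using comb_delta[of j id] j by (simp add: comb_coeff)
  finally have "comb id ?w = 0\<^sub>v k" using j by simp
  then have "comb s ?w \<bullet> comb s ?w = 0" using comb_norm[OF s gram, of ?w] by simp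
  then have z: "comb s ?w $ a = 0" if "a < k" for a using self_scalar_prod_zero[OF comb_carrier _ that] by blast
  show "comb s (coeff (f j)) = f (s j)"
  proof (rule eq_vecI)
    fix a assume "a < dim_vec (f (s j))"
    then have "a < k" using s[OF j] by simp
    then have "(comb s (coeff (f j)) - f (s j)) $ a = 0" using z by (simp only: eq)
    then show "comb s (coeff (f j)) $ a = f (s j) $ a" using \<open>a < k\<close> s[OF j] by simp
  qed (use s[OF j] in \<open>simp add: comb_def\<close>)
qed auto

abbreviation "Isom \<equiv> isometry_group k (f ` {..<n})"

lemma isometry_groupD:
  assumes "h \<in> carrier Isom"
  shows "h \<in> Bij (carrier_vec k)" and "h ` f ` {..<n} = f ` {..<n}"
    and "\<And>x. x \<in> carrier_vec k \<Longrightarrow> h x \<in> carrier_vec k"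
    and "\<And>x y. x \<in> carrier_vec k \<Longrightarrow> y \<in> carrier_vec k \<Longrightarrow> vnorm (h x - h y) = vnorm (x - y)"
  using assms by (auto simp: isometry_group_def Bij_def bij_betw_def)

text \<open>Every point is \<open>h (f j)\<close> for some \<open>j\<close>, so \<open>h x\<close>
  and \<open>h' x\<close> have the same distances to all points. Off the carrier both maps agree
  because they are extensional.\<close>

lemma isometry_unique:
  assumes h: "h \<in> carrier Isom" and h': "h' \<in> carrier Isom"
    and agree: "\<And>i. i < n \<Longrightarrow> h (f i) = h' (f i)"
  shows "h = h'"
proof (rule extensionalityI[of _ "carrier_vec k"])
  show "h \<in> extensional (carrier_vec k)" "h' \<in> extensional (carrier_vec k)"
    using isometry_groupD(1)[OF h] isometry_groupD(1)[OF h'] by (auto simp: Bij_def)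
  fix x :: "real vec" assume x: "x \<in> carrier_vec k"
  show "h x = h' x"
  proof (rule eq_if_equidistant)
    fix i assume "i < n"
    then have "f i \<in> h ` f ` {..<n}" using isometry_groupD(2)[OF h] by auto
    then obtain j where j: "j < n" "f i = h (f j)" by auto
    have "vnorm (h x - h (f j)) = vnorm (h' x - h' (f j))"
      using isometry_groupD(4)[OF h x f[OF j(1)]] isometry_groupD(4)[OF h' x f[OF j(1)]] by simp
    then show "vnorm (h x - f i) = vnorm (h' x - f i)" using j agree by simp
  qed (use x isometry_groupD(3)[OF h] isometry_groupD(3)[OF h'] in auto)
qed

text \<open>Both \<open>s\<close> and its inverse extend to distance-preserving maps
  \<open>U\<close> and \<open>V\<close>. Their composites fix all points, hence are the identity by
  equidistance, so \<open>U\<close> is a bijection.\<close>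

lemma isometry_extension:
  assumes s: "bij_betw s {..<n} {..<n}"
    and gram: "\<And>i j. i < n \<Longrightarrow> j < n \<Longrightarrow> f (s i) \<bullet> f (s j) = f i \<bullet> f j"
  shows "\<exists>h\<in>carrier Isom. \<forall>i<n. h (f i) = f (s i)"
proof -
  define t where "t = inv_into {..<n} s"
  have t: "bij_betw t {..<n} {..<n}" unfolding t_def by (rule bij_betw_inv_into[OF s])
  have sn: "s i < n" and tn: "t i < n" if "i < n" for i
    using that s t by (auto simp: bij_betw_def)
  have st: "s (t i) = i" and ts: "t (s i) = i" if "i < n" for i
    using that s by (auto simp: t_def bij_betw_inv_into_left bij_betw_inv_into_right)
  have gram': "f (t i) \<bullet> f (t j) = f i \<bullet> f j" if "i < n" "j < n" for i j
    using gram[of "t i" "t j"] that by (simp add: tn st)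
  obtain U where U: "\<And>x. x \<in> carrier_vec k \<Longrightarrow> U x \<in> carrier_vec k"
    "\<And>x y. x \<in> carrier_vec k \<Longrightarrow> y \<in> carrier_vec k \<Longrightarrow> vnorm (U x - U y) = vnorm (x - y)"
    "\<And>i. i < n \<Longrightarrow> U (f i) = f (s i)"
    using isometry_extension_exists[of s, OF sn gram] by metis
  obtain V where V: "\<And>x. x \<in> carrier_vec k \<Longrightarrow> V x \<in> carrier_vec k"
    "\<And>x y. x \<in> carrier_vec k \<Longrightarrow> y \<in> carrier_vec k \<Longrightarrow> vnorm (V x - V y) = vnorm (x - y)"
    "\<And>i. i < n \<Longrightarrow> V (f i) = f (t i)"
    using isometry_extension_exists[of t, OF tn gram'] by metis
  have VU: "V (U x) = x" if x: "x \<in> carrier_vec k" for x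
  proof (rule eq_if_equidistant)
    fix i assume i: "i < n"
    have "f i = V (U (f i))" using i by (simp add: U V sn ts)
    then show "vnorm (V (U x) - f i) = vnorm (x - f i)"
      using V(2)[of "U x" "U (f i)"] U(2)[of x "f i"] x i U(1) by simp
  qed (use x U V in auto)
  have UV: "U (V x) = x" if x: "x \<in> carrier_vec k" for x
  proof (rule eq_if_equidistant)
    fix i assume i: "i < n"
    have "f i = U (V (f i))" using i by (simp add: U V tn st)
    then show "vnorm (U (V x) - f i) = vnorm (x - f i)"
      using U(2)[of "V x" "V (f i)"] V(2)[of x "f i"] x i V(1) by simp
  qed (use x U V in auto)
  have "bij_betw U (carrier_vec k) (carrier_vec k)"
    by (rule bij_betw_byWitness[of _ V]) (use U V UV VU in auto)
  then have "restrict U (carrier_vec k) \<in> Bij (carrier_vec k)"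
    by (simp add: Bij_def bij_betw_restrict_eq)
  moreover have "restrict U (carrier_vec k) ` f ` {..<n} = f ` {..<n}"
  proof -
    have "restrict U (carrier_vec k) ` f ` {..<n} = f ` s ` {..<n}"
      unfolding image_image by (rule image_cong) (auto simp: U)
    then show ?thesis using s by (simp add: bij_betw_def)
  qed
  ultimately have "restrict U (carrier_vec k) \<in> carrier Isom"
    using U(2) by (simp add: isometry_group_def)
  then show ?thesis using U(3) by (intro bexI[of _ "restrict U (carrier_vec k)"]) auto
qed

text \<open>Injectivity of \<open>f\<close> transports the permutation of the image to the
  indices.\<close>

lemma isometry_restriction:
  assumes h: "h \<in> carrier Isom"
  shows "\<exists>s\<in>Bij {..<n}. \<forall>i<n. h (f i) = f (s i)"
proof -
  have bf: "bij_betw f {..<n} (f ` {..<n})" using inj by (simp add: bij_betw_def)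
  have "inj_on h (carrier_vec k)" using isometry_groupD(1)[OF h] by (simp add: Bij_def bij_betw_def)
  then have "inj_on h (f ` {..<n})" by (rule inj_on_subset) auto
  then have "bij_betw h (f ` {..<n}) (f ` {..<n})"
    using isometry_groupD(2)[OF h] by (simp add: bij_betw_def)
  then have b: "bij_betw (inv_into {..<n} f \<circ> (h \<circ> f)) {..<n} {..<n}"
    using bf bij_betw_inv_into[OF bf] by (blast intro: bij_betw_trans)
  show ?thesis
  proof (intro bexI[of _ "restrict (inv_into {..<n} f \<circ> (h \<circ> f)) {..<n}"] allI impI)
    show "restrict (inv_into {..<n} f \<circ> (h \<circ> f)) {..<n} \<in> Bij {..<n}"
      unfolding Bij_def using b by (simp add: bij_betw_restrict_eq del: comp_apply o_apply)
    fix i assume i: "i < n"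
    then have "h (f i) \<in> f ` {..<n}" using isometry_groupD(2)[OF h] by blast
    then show "h (f i) = f (restrict (inv_into {..<n} f \<circ> (h \<circ> f)) {..<n} i)"
      using i by (simp add: f_inv_into_f)
  qed
qed

text \<open>The isomorphism sends an automorphism to the isometry that extends its action on the
  points. The first hypothesis provides the extension; the second makes the index permutation
  induced by any isometry an automorphism, which gives surjectivity.\<close>

lemma Aut_iso_isometry_group:
  assumes Aut_gram: "\<And>s i j. s \<in> carrier (Aut n G) \<Longrightarrow> i < n \<Longrightarrow> j < n \<Longrightarrow>
      f (s i) \<bullet> f (s j) = f i \<bullet> f j"
    and dist_mu: "\<And>s i j. s \<in> Bij {..<n} \<Longrightarrow>
      (\<And>i j. i < n \<Longrightarrow> j < n \<Longrightarrow> vnorm (f (s i) - f (s j)) = vnorm (f i - f j)) \<Longrightarrow>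
      i < n \<Longrightarrow> j < n \<Longrightarrow> mu G (s i) (s j) = mu G i j"
  shows "Aut n G \<cong> Isom"
proof -
  have AutB: "s \<in> Bij {..<n}" "bij_betw s {..<n} {..<n}" "\<And>i. i < n \<Longrightarrow> s i < n"
    if "s \<in> carrier (Aut n G)" for s
    using that by (auto simp: Aut_def Bij_def bij_betw_def)
  \<comment> \<open>The choice is harmless: an isometry is determined by its values on the points,
    which also makes \<open>ext\<close> a homomorphism.\<close>
  define ext where "ext s = (SOME h. h \<in> carrier Isom \<and> (\<forall>i<n. h (f i) = f (s i)))" for s
  have ext: "ext s \<in> carrier Isom" "\<And>i. i < n \<Longrightarrow> ext s (f i) = f (s i)"
    if "s \<in> carrier (Aut n G)" for s
  proof -
    have "\<exists>h. h \<in> carrier Isom \<and> (\<forall>i<n. h (f i) = f (s i))"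
      using isometry_extension[OF AutB(2)[OF that] Aut_gram[OF that]] by blast
    then have "ext s \<in> carrier Isom \<and> (\<forall>i<n. ext s (f i) = f (s i))"
      unfolding ext_def by (rule someI_ex)
    then show "ext s \<in> carrier Isom" "\<And>i. i < n \<Longrightarrow> ext s (f i) = f (s i)" by auto
  qed
  have "ext \<in> hom (Aut n G) Isom"
  proof (rule homI)
    fix s t assume s: "s \<in> carrier (Aut n G)" and t: "t \<in> carrier (Aut n G)"
    have st: "s \<otimes>\<^bsub>Aut n G\<^esub> t = compose {..<n} s t"
      using AutB(1)[OF s] AutB(1)[OF t] by (simp add: Aut_def BijGroup_def)
    have stc: "compose {..<n} s t \<in> carrier (Aut n G)"
      using s t AutB(3)[OF t] compose_Bij[OF AutB(1)[OF s] AutB(1)[OF t]]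
      by (auto simp: Aut_def compose_eq)
    have e: "ext s \<otimes>\<^bsub>Isom\<^esub> ext t = compose (carrier_vec k) (ext s) (ext t)"
      using isometry_groupD(1)[OF ext(1)[OF s]] isometry_groupD(1)[OF ext(1)[OF t]]
      by (simp add: isometry_group_def BijGroup_def)
    have img: "compose (carrier_vec k) (ext s) (ext t) ` f ` {..<n} = ext s ` ext t ` f ` {..<n}"
      unfolding image_image by (rule image_cong) (auto simp: compose_eq)
    have ec: "compose (carrier_vec k) (ext s) (ext t) \<in> carrier Isom"
      using compose_Bij[OF isometry_groupD(1)[OF ext(1)[OF s]] isometry_groupD(1)[OF ext(1)[OF t]]]
        img isometry_groupD(2-4)[OF ext(1)[OF s]] isometry_groupD(2-4)[OF ext(1)[OF t]]
      by (simp add: isometry_group_def compose_eq)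
    show "ext (s \<otimes>\<^bsub>Aut n G\<^esub> t) = ext s \<otimes>\<^bsub>Isom\<^esub> ext t"
      unfolding st e
      by (rule isometry_unique[OF ext(1)[OF stc] ec])
        (simp add: ext[OF stc] ext[OF t] ext[OF s] AutB(3)[OF t] compose_eq)
  qed (use ext in auto)
  moreover have "bij_betw ext (carrier (Aut n G)) (carrier Isom)"
    unfolding bij_betw_def
  proof (intro conjI equalityI subsetI)
    show "inj_on ext (carrier (Aut n G))"
    proof (rule inj_onI)
      fix s t assume s: "s \<in> carrier (Aut n G)" and t: "t \<in> carrier (Aut n G)" and eq: "ext s = ext t"
      have "s i = t i" if i: "i < n" for i
      proof -
        have "f (s i) = f (t i)" using ext(2)[OF s i] ext(2)[OF t i] eq by simp
        then show ?thesis using inj AutB(3)[OF s i] AutB(3)[OF t i] by (auto dest: inj_onD)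
      qed
      then show "s = t" using AutB(1)[OF s] AutB(1)[OF t]
        by (intro extensionalityI[of _ "{..<n}"]) (auto simp: Bij_def)
    qed
    show "h \<in> carrier Isom" if "h \<in> ext ` carrier (Aut n G)" for h using that ext by auto
    fix h assume h: "h \<in> carrier Isom"
    obtain s where s: "s \<in> Bij {..<n}" "\<And>i. i < n \<Longrightarrow> h (f i) = f (s i)"
      using isometry_restriction[OF h] by blast
    have "vnorm (f (s i) - f (s j)) = vnorm (f i - f j)" if "i < n" "j < n" for i j
      using isometry_groupD(4)[OF h f[OF that(1)] f[OF that(2)]] s(2) that by simp
    then have "s \<in> carrier (Aut n G)" using s(1) dist_mu[OF s(1)] by (simp add: Aut_def)
    moreover from this have "h = ext s" by (intro isometry_unique[OF h]) (auto simp: ext s)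
    ultimately show "h \<in> ext ` carrier (Aut n G)" by blast
  qed
  ultimately show ?thesis by (auto simp: is_iso_def iso_def)
qed

end

section \<open>Double centering: the entries of \<open>Lam P\<close>\<close>

lemma mult_entry:
  assumes "A \<in> carrier_mat n m" "B \<in> carrier_mat m k" "i < n" "j < k"
  shows "(A * B) $$ (i, j) = (\<Sum>l<m. A $$ (i, l) * B $$ (l, j))"
  using assms by (simp add: scalar_prod_def atLeast0LessThan)

text \<open>Multiplication by the centering matrix on the left subtracts column means, on the right
  row means. Symmetry of \<open>P\<close> lets the mean of column \<open>j\<close> be written as
  that of row \<open>j\<close>.\<close>

lemma Lam_entry:
  assumes P: "P \<in> carrier_mat n n" and sym: "P\<^sup>T = P" and ij: "i < n" "j < n"
  shows "Lam P $$ (i, j) = - (P $$ (i, j) - (\<Sum>k<n. P $$ (i, k)) / n - (\<Sum>k<n. P $$ (j, k)) / n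
    + (\<Sum>l<n. \<Sum>k<n. P $$ (l, k)) / (n * n)) / 2"
proof -
  define C where "C = 1\<^sub>m n - (1 / real n) \<cdot>\<^sub>m ones_mat n"
  have C: "C \<in> carrier_mat n n"
    and Ce: "\<And>i j. i < n \<Longrightarrow> j < n \<Longrightarrow> C $$ (i, j) = (if i = j then 1 else 0) - 1 / n"
    by (auto simp: C_def ones_mat_def)
  have Ps: "P $$ (i, j) = P $$ (j, i)" if "i < n" "j < n" for i j
    using that P by (metis carrier_matD index_transpose_mat(1) sym)
  have CP: "(C * P) $$ (i, j) = P $$ (i, j) - (\<Sum>k<n. P $$ (j, k)) / n" if "i < n" "j < n" for i j
  proof -
    have "(C * P) $$ (i, j) = (\<Sum>k<n. C $$ (i, k) * P $$ (k, j))"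
      using that C P by (intro mult_entry)
    also have "\<dots> = (\<Sum>k<n. (if k = i then P $$ (i, j) else 0) - P $$ (j, k) / n)"
      using that by (intro sum.cong) (auto simp: Ce Ps[of _ j] algebra_simps)
    finally show ?thesis using that by (simp add: sum_subtractf sum_divide_distrib)
  qed
  have "(C * P * C) $$ (i, j) = (\<Sum>k<n. (C * P) $$ (i, k) * C $$ (k, j))"
    using ij C P by (intro mult_entry) auto
  also have "\<dots> = (\<Sum>k<n. (if k = j then (C * P) $$ (i, j) else 0) - (C * P) $$ (i, k) / n)"
    using ij by (intro sum.cong) (auto simp: Ce algebra_simps)
  also have "\<dots> = (C * P) $$ (i, j) - (\<Sum>k<n. (C * P) $$ (i, k)) / n"
    using ij by (simp add: sum_subtractf sum_divide_distrib del: index_mult_mat(1))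
  also have "(\<Sum>k<n. (C * P) $$ (i, k)) = (\<Sum>k<n. P $$ (i, k)) - (\<Sum>l<n. \<Sum>k<n. P $$ (l, k)) / n"
    using ij by (simp add: CP sum_subtractf sum_divide_distrib del: index_mult_mat(1))
  finally have e: "(C * P * C) $$ (i, j) = P $$ (i, j) - (\<Sum>k<n. P $$ (j, k)) / n
     - ((\<Sum>k<n. P $$ (i, k)) - (\<Sum>l<n. \<Sum>k<n. P $$ (l, k)) / n) / n"
    using ij by (simp only: CP)
  have "Lam P = (- 1 / 2) \<cdot>\<^sub>m (C * P * C)" using P by (simp add: Lam_def Let_def C_def)
  moreover have "C * P * C \<in> carrier_mat n n" using C P by simp
  ultimately have "Lam P $$ (i, j) = (- 1 / 2) * (C * P * C) $$ (i, j)"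
    using ij by (metis carrier_matD index_smult_mat(1))
  then show ?thesis unfolding e by (simp add: diff_divide_distrib add_divide_distrib)
qed

lemma Lam_carrier: "P \<in> carrier_mat n n \<Longrightarrow> Lam P \<in> carrier_mat n n"
  by (auto simp: Lam_def Let_def ones_mat_def)

lemma Lam_symmetric:
  assumes P: "P \<in> carrier_mat n n" and sym: "P\<^sup>T = P"
  shows "(Lam P)\<^sup>T = Lam P"
proof (rule eq_matI)
  have Ps: "P $$ (i, j) = P $$ (j, i)" if "i < n" "j < n" for i j
    using that P by (metis carrier_matD index_transpose_mat(1) sym)
  fix i j assume "i < dim_row (Lam P)" "j < dim_col (Lam P)"
  then have "i < n" "j < n" using Lam_carrier[OF P] by auto
  then show "(Lam P)\<^sup>T $$ (i, j) = Lam P $$ (i, j)"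
    using Lam_carrier[OF P] Ps[of i j] by (simp add: Lam_entry[OF P sym])
qed (use Lam_carrier[OF P] in auto)

lemma Lam_row_sum:
  assumes P: "P \<in> carrier_mat n n" and sym: "P\<^sup>T = P" and i: "i < n"
  shows "(\<Sum>j<n. Lam P $$ (i, j)) = 0"
proof -
  define r where "r i = (\<Sum>k<n. P $$ (i, k))" for i
  define t where "t = (\<Sum>l<n. r l)"
  have "(\<Sum>j<n. Lam P $$ (i, j)) = (\<Sum>j<n. - (P $$ (i, j) - r i / n - r j / n + t / (n * n)) / 2)"
    using i by (intro sum.cong) (auto simp: Lam_entry[OF P sym] r_def t_def)
  also have "\<dots> = - (r i - r i - t / n + t / n) / 2"
    using i by (simp add: sum_divide_distrib[symmetric] sum_negf sum.distrib sum_subtractf r_def[symmetric] t_def)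
  finally show ?thesis by simp
qed

text \<open>The means cancel, and the diagonal of \<open>P\<close> is 0. So \<open>Lam P\<close>,
  even when indefinite, relates to \<open>P\<close> as a Gram matrix does to the squared
  distances.\<close>

lemma Lam_distance:
  assumes "predistance_matrix n P" and ij: "i < n" "j < n"
  shows "Lam P $$ (i, i) + Lam P $$ (j, j) - 2 * Lam P $$ (i, j) = P $$ (i, j)"
proof -
  have P: "P \<in> carrier_mat n n" and sym: "P\<^sup>T = P" and z: "P $$ (i, i) = 0" "P $$ (j, j) = 0"
    using assms by (auto simp: predistance_matrix_def)
  show ?thesis using ij z by (simp add: Lam_entry[OF P sym] field_simps)
qed

text \<open>Reindexing along \<open>s\<close> shows that row sums and the total sum are
  unchanged.\<close>

lemma Lam_permute:
  assumes P: "P \<in> carrier_mat n n" and sym: "P\<^sup>T = P" and s: "bij_betw s {..<n} {..<n}"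
    and inv: "\<And>i j. i < n \<Longrightarrow> j < n \<Longrightarrow> P $$ (s i, s j) = P $$ (i, j)" and ij: "i < n" "j < n"
  shows "Lam P $$ (s i, s j) = Lam P $$ (i, j)"
proof -
  have sn: "s i < n" if "i < n" for i using s that by (auto simp: bij_betw_def)
  have r: "(\<Sum>k<n. P $$ (s i, k)) = (\<Sum>k<n. P $$ (i, k))" if "i < n" for i
    using that by (subst sum.reindex_bij_betw[OF s, symmetric]) (simp add: inv)
  show ?thesis using ij by (simp add: Lam_entry[OF P sym] sn inv r)
qed

text \<open>Row sums of \<open>Lam P\<close> vanish, so the normalized all-ones vector is an
  eigenvector for 0 and can be prescribed as the first column.\<close>

lemma Lam_diagonalization:
  assumes n: "n \<ge> 2" and P: "P \<in> carrier_mat n n" and sym: "P\<^sup>T = P"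
  shows "\<exists>Q d. centered_diagonalization n (Lam P) Q d"
proof -
  obtain m where m: "n = Suc m" using n by (cases n) auto
  define u where "u = vec n (\<lambda>_. 1 / sqrt n)"
  have u: "u \<in> carrier_vec n" "u \<bullet> u = 1" using n by (auto simp: u_def scalar_prod_def)
  have "Lam P *\<^sub>v u = 0 \<cdot>\<^sub>v u"
  proof (rule eq_vecI)
    fix i assume "i < dim_vec (0 \<cdot>\<^sub>v u)"
    then have i: "i < n" by (simp add: u_def)
    then have "(Lam P *\<^sub>v u) $ i = (\<Sum>j<n. Lam P $$ (i, j)) / sqrt n"
      using Lam_carrier[OF P] by (simp add: u_def scalar_prod_def atLeast0LessThan sum_divide_distrib)
    then show "(Lam P *\<^sub>v u) $ i = (0 \<cdot>\<^sub>v u) $ i" using i Lam_row_sum[OF P sym i] by (simp add: u_def)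
  qed (use Lam_carrier[OF P] in \<open>simp add: u_def\<close>)
  then obtain Q d where Q: "Q \<in> carrier_mat n n" "Q\<^sup>T * Q = 1\<^sub>m n"
    "Lam P * Q = Q * mat_diag n d" "col Q 0 = u" "d 0 = 0"
    using spectral_extend[of "Lam P" m u 0] Lam_carrier[OF P] Lam_symmetric[OF P sym] u
      symmetric_diagonalization m by metis
  have "Q $$ (i, 0) = 1 / sqrt n" if "i < n" for i
  proof -
    have "Q $$ (i, 0) = col Q 0 $ i" using that Q(1) by simp
    then show ?thesis using that by (simp add: Q(4) u_def)
  qed
  then have "centered_diagonalization n (Lam P) Q d"
    using Q Lam_carrier[OF P] n by unfold_locales auto
  then show ?thesis by blast
qed

section \<open>The embedding by scaled eigenvectors\<close>

context centered_diagonalization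
begin

abbreviation "axes_set \<equiv> {s\<in>{1..<n}. d s \<noteq> lam}"

text \<open>The coordinates of \<open>f i\<close> are the entries of row \<open>i\<close> of
  \<open>Q\<close> on \<open>axes_set\<close>, scaled by \<open>sqrt (d s - lam)\<close>. The
  resulting Gram matrix is \<open>A\<close> minus \<open>lam\<close> times the orthogonal projection
  onto the complement of the all-ones vector.\<close>

lemma principal_axes_embedding:
  obtains f :: "nat \<Rightarrow> real vec" and c where
    "\<And>i. i < n \<Longrightarrow> f i \<in> carrier_vec (card axes_set)"
    "\<And>a. a < card axes_set \<Longrightarrow> (\<Sum>i<n. f i $ a) = 0"
    "\<And>a b. a < card axes_set \<Longrightarrow> b < card axes_set \<Longrightarrow>
      (\<Sum>i<n. f i $ a * f i $ b) = (if a = b then c a else 0)"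
    "\<And>a. a < card axes_set \<Longrightarrow> c a \<noteq> 0"
    "\<And>i j. i < n \<Longrightarrow> j < n \<Longrightarrow> f i \<bullet> f j = A $$ (i, j) - lam * ((if i = j then 1 else 0) - 1 / n)"
proof -
  let ?k = "card axes_set"
  obtain e where e: "bij_betw e {..<?k} axes_set"
    using ex_bij_betw_nat_finite[of axes_set] by (auto simp: atLeast0LessThan)
  have es: "e a \<in> axes_set" if "a < ?k" for a using e that by (auto simp: bij_betw_def)
  have pos: "d s - lam \<ge> 0" if "s \<in> {1..<n}" for s using lam_le[OF that] by simp
  define f where "f i = vec ?k (\<lambda>a. sqrt (d (e a) - lam) * Q $$ (i, e a))" for i
  define c where "c a = d (e a) - lam" for a
  show ?thesis
  proof (rule that[of f c])
    show "f i \<in> carrier_vec ?k" for i by (simp add: f_def)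
    show "c a \<noteq> 0" if "a < ?k" for a using es[OF that] by (simp add: c_def)
    show "(\<Sum>i<n. f i $ a) = 0" if "a < ?k" for a
      using that es[OF that] Q_centered[of "e a"] by (simp add: f_def sum_distrib_left[symmetric])
    show "(\<Sum>i<n. f i $ a * f i $ b) = (if a = b then c a else 0)" if ab: "a < ?k" "b < ?k" for a b
    proof -
      have "(\<Sum>i<n. f i $ a * f i $ b) =
          sqrt (d (e a) - lam) * sqrt (d (e b) - lam) * (\<Sum>i<n. Q $$ (i, e a) * Q $$ (i, e b))"
        using ab by (simp add: f_def sum_distrib_left mult_ac)
      moreover have "(e a = e b) = (a = b)" using e ab by (auto simp: bij_betw_def inj_on_def)
      ultimately show ?thesis using es[OF ab(1)] es[OF ab(2)] pos[of "e a"]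
        by (auto simp: Q_cols c_def)
    qed
    fix i j assume ij: "i < n" "j < n"
    have "f i \<bullet> f j = (\<Sum>a<?k. (d (e a) - lam) * Q $$ (i, e a) * Q $$ (j, e a))"
      unfolding f_def scalar_prod_def using pos es
      by (auto simp: atLeast0LessThan real_sqrt_mult_self mult.assoc[symmetric] intro!: sum.cong)
    also have "\<dots> = (\<Sum>s\<in>axes_set. (d s - lam) * Q $$ (i, s) * Q $$ (j, s))"
      by (rule sum.reindex_bij_betw[OF e])
    \<comment> \<open>The added indices have \<open>d s = lam\<close> and contribute 0.\<close>
    also have "\<dots> = (\<Sum>s\<in>{1..<n}. (d s - lam) * Q $$ (i, s) * Q $$ (j, s))"
      by (rule sum.mono_neutral_left) auto
    \<comment> \<open>The new term \<open>s = 0\<close> is \<open>(0 - lam) * (1 / n)\<close>, which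
      \<open>lam / n\<close> compensates.\<close>
    also have "\<dots> = (\<Sum>s<n. (d s - lam) * Q $$ (i, s) * Q $$ (j, s)) + lam / n"
    proof -
      have "{..<n} = insert 0 {1..<n}" using n2 by auto
      then show ?thesis using ij n2 by (simp add: d0 col0)
    qed
    also have "\<dots> = A $$ (i, j) - lam * (\<Sum>s<n. Q $$ (i, s) * Q $$ (j, s)) + lam / n"
      using ij by (simp add: A_entry sum_subtractf sum_distrib_left left_diff_distrib mult.assoc)
    finally show "f i \<bullet> f j = A $$ (i, j) - lam * ((if i = j then 1 else 0) - 1 / n)"
      using ij by (simp add: Q_rows right_diff_distrib)
  qed
qed

end

section \<open>Distances and regularity of the embedding\<close>

theorem mainTheorem8:
  fixes n :: nat and G :: mgraph and P :: "real mat"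
  assumes "n \<ge> 2"
    and "loopless_mgraph n G"
    and "irreducible_mgraph n G"
    and "predistance_matrix n P"
    and "commuting_matrix n G P"
    and "reconstructing_matrix n G P"
  shows "\<exists>f. regular_embedding n G (zeta P) f \<and>
    (\<forall>i<n. \<forall>j<n. i \<noteq> j \<longrightarrow>
       (vnorm (f i - f j))\<^sup>2 = P $$ (i, j) - 2 * Min (spectrum_perp_ones (Lam P)))"
proof -
  have P: "P \<in> carrier_mat n n" and sym: "P\<^sup>T = P" and diag: "\<And>i. i < n \<Longrightarrow> P $$ (i, i) = 0"
    using assms(4) by (auto simp: predistance_matrix_def)
  obtain \<Xi> where \<Xi>: "\<And>i j. i < n \<Longrightarrow> j < n \<Longrightarrow> mu G i j = \<Xi> (P $$ (i, j))"
    using assms(6) by (auto simp: reconstructing_matrix_def)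
  \<comment> \<open>\<open>{i, i}\<close> is a singleton, hence not an edge.\<close>
  have mu0: "mu G i i = 0" for i
    using assms(2) by (force simp: mu_def loopless_mgraph_def count_eq_zero_iff)
  obtain Q d where "centered_diagonalization n (Lam P) Q d"
    using Lam_diagonalization[OF assms(1) P sym] by blast
  then interpret centered_diagonalization n "Lam P" Q d .
  let ?k = "card axes_set"
  obtain f c where f: "\<And>i. i < n \<Longrightarrow> f i \<in> carrier_vec ?k"
    and ctr: "\<And>a. a < ?k \<Longrightarrow> (\<Sum>i<n. f i $ a) = 0"
    and ax: "\<And>a b. a < ?k \<Longrightarrow> b < ?k \<Longrightarrow> (\<Sum>i<n. f i $ a * f i $ b) = (if a = b then c a else 0)"
    and c0: "\<And>a. a < ?k \<Longrightarrow> c a \<noteq> (0::real)"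
    and gram: "\<And>i j. i < n \<Longrightarrow> j < n \<Longrightarrow>
      f i \<bullet> f j = Lam P $$ (i, j) - lam * ((if i = j then 1 else 0) - 1 / n)"
    using principal_axes_embedding by blast
  \<comment> \<open>For distinct indices the projection contributes
    \<open>2 * (1 - 1 / n) + 2 / n = 2\<close>, hence the shift by \<open>2 * lam\<close>.\<close>
  have dist: "(f i - f j) \<bullet> (f i - f j) = P $$ (i, j) - 2 * lam" if "i < n" "j < n" "i \<noteq> j" for i j
    using that Lam_distance[OF assms(4) that(1,2)]
    by (simp add: sq_dist_vec[OF f f] gram right_diff_distrib)
  \<comment> \<open>Off the diagonal the distance determines the entry of \<open>P\<close>, and
    \<open>\<Xi>\<close> turns that entry into \<open>mu\<close>.\<close>
  have mu_eq: "mu G i j = mu G i' j'"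
    if "i < n" "j < n" "i' < n" "j' < n" "i \<noteq> j" "i' \<noteq> j'" "vnorm (f i - f j) = vnorm (f i' - f j')"
    for i j i' j'
    using that dist[of i j] dist[of i' j'] \<Xi>[of i j] \<Xi>[of i' j'] by (simp add: vnorm_eq_iff)
  have inj: "inj_on f {..<n}"
  proof (rule inj_onI, rule ccontr)
    fix x y assume xy: "x \<in> {..<n}" "y \<in> {..<n}" "f x = f y" "x \<noteq> y"
    \<comment> \<open>Coinciding images have equal distances to the image of every other
      vertex.\<close>
    then have "twins n G x y" by (auto simp: twins_def intro!: mu_eq)
    then show False using assms(3) by (auto simp: irreducible_mgraph_def)
  qed
  interpret frame: centered_frame n ?k c f
    using f inj assms(1) ctr ax c0 by unfold_locales auto
  have "Aut n G \<cong> isometry_group ?k (f ` {..<n})"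
  proof (rule frame.Aut_iso_isometry_group)
    fix s i j assume s: "s \<in> carrier (Aut n G)" and ij: "i < n" "j < n"
    have b: "bij_betw s {..<n} {..<n}" using s by (auto simp: Aut_def Bij_def)
    have "P $$ (s i, s j) = P $$ (i, j)" if "i < n" "j < n" for i j
      using assms(5) s that by (auto simp: commuting_matrix_def)
    then have "Lam P $$ (s i, s j) = Lam P $$ (i, j)" using Lam_permute[OF P sym b] ij by blast
    moreover have "(s i = s j) = (i = j)" using b ij by (auto simp: bij_betw_def inj_on_def)
    moreover have "s i < n" "s j < n" using b ij by (auto simp: bij_betw_def)
    ultimately show "f (s i) \<bullet> f (s j) = f i \<bullet> f j" using ij by (simp add: gram)
  next
    fix s i j assume s: "s \<in> Bij {..<n}" and ij: "i < n" "j < n"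
      and iso: "\<And>i j. i < n \<Longrightarrow> j < n \<Longrightarrow> vnorm (f (s i) - f (s j)) = vnorm (f i - f j)"
    have b: "bij_betw s {..<n} {..<n}" using s by (auto simp: Bij_def)
    have sn: "s i < n" "s j < n" using b ij by (auto simp: bij_betw_def)
    show "mu G (s i) (s j) = mu G i j"
    \<comment> \<open>The distance formula is confined to distinct indices; on the diagonal both
      multiplicities are 0.\<close>
    proof (cases "i = j")
      case False
      then have "s i \<noteq> s j" using b ij by (auto simp: bij_betw_def inj_on_def)
      then show ?thesis using mu_eq[OF sn ij _ False iso[OF ij]] by simp
    qed (simp add: mu0)
  qed
  moreover have "zeta P = ?k" using P by (intro zeta_A) auto
  moreover have "Min (spectrum_perp_ones (Lam P)) = lam" by (simp add: spectrum_perp_ones_A lam_def)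
  moreover have "(vnorm (f i - f j))\<^sup>2 = (f i - f j) \<bullet> (f i - f j)" for i j
    by (simp add: vnorm_def scalar_prod_def sum_nonneg)
  ultimately show ?thesis using f dist
    by (intro exI[of _ f]) (auto simp: regular_embedding_def)
qed

end
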